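(* Consider, for $h>0$, the entropy function (total energy) of the shallow water moment equations $$\mathbb{E}(\boldsymbol{u}) = \frac{h u_m^2}{2}+ \frac{h}{2}\sum_{i=1}^N\frac{\alpha_i^2}{2i+1}+ g \frac{h^2}{2}+g h b$$ as a function of the conservative variables $\boldsymbol{u}=(h,hu_m,h\alpha_1,\dots,h\alpha_N)^{\rm T}\in\mathbb{R}^{N+2}$. The associated entropy variables $w_1,\dots,w_{N+2}$, i.e. $w_\ell=\partial\mathbb{E}/\partial u_\ell$, are $$w_1 = -\frac{u_m^2}{2}- \frac{1}{2}\sum_{i=1}^N\frac{\alpha_i^2}{2i+1}+g(h+b), \qquad w_2 = u_m,\qquad w_{i+2} = \frac{\alpha_i}{2i+1}\quad (i=1,\dots,N).$$ Furthermore, the Hessian of $\mathbb{E}$ with respect to the conservative variables $\boldsymbol{u}$ is $$\mathbf{H}^{-1} = \frac{1}{h}\begin{pmatrix} gh + u_m^2 + \sum_{i=1}^N \frac{\alpha_i^2}{2i + 1} & -u_m & - \frac{\alpha_1}{3} & \dots & -\frac{\alpha_N}{2N + 1} \\ -u_m & 1 & 0 & \dots & 0 \\ -\frac{\alpha_1}{3} & 0 & \frac{1}{3} & \ddots & \vdots \\ \vdots & \vdots & \ddots & \ddots & 0 \\ -\frac{\alpha_N}{2N+1} & 0 & \dots & 0 & \frac{1}{2N + 1} \end{pmatrix}.$$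
   Context: $N\ge 1$ is an integer, $g>0$ is the gravitational constant, and the bathymetry value $b\in\mathbb{R}$ is regarded as a fixed parameter (it is not one of the conservative variables here). The primitive quantities $u_m,\alpha_1,\dots,\alpha_N$ are obtained from $\boldsymbol{u}$ by dividing the components $hu_m,h\alpha_1,\dots,h\alpha_N$ by $h$. The entropy variables are by definition the partial derivatives of $\mathbb{E}$ with respect to the components of $\boldsymbol{u}$. The notation $\mathbf{H}^{-1}$ is simply the name of the Hessian matrix; its lower right $(N+1)\times(N+1)$ block (without the factor $1/h$) is the diagonal matrix $\mathrm{diag}(1,\tfrac13,\tfrac15,\dots,\tfrac1{2N+1})$. *)

theory Defs
  imports Complex_Main "Jordan_Normal_Form.Matrix"
begin

text \<open>Components of vectors and entries of matrices are counted from 0: the \<open>l\<close>-th variable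
  of the literature is component \<open>l - 1\<close>.\<close>

definition has_partial_derivative :: "(real vec \<Rightarrow> real) \<Rightarrow> real \<Rightarrow> nat \<Rightarrow> real vec \<Rightarrow> bool" where
  "has_partial_derivative f D l u \<longleftrightarrow>
     ((\<lambda>t. f (u |\<^sub>v l \<mapsto> t)) has_real_derivative D) (at (u $ l))"

text \<open>The entry \<open>(k, l)\<close> of the Hessian is the partial derivative with respect to the variable
  \<open>k\<close> of the partial derivative of \<open>f\<close> with respect to the variable \<open>l\<close>. The inner partial
  derivative \<open>G\<close> has to exist near \<open>u\<close> along the direction \<open>k\<close>, where it is then
  uniquely determined.\<close>

definition has_hessian :: "(real vec \<Rightarrow> real) \<Rightarrow> real mat \<Rightarrow> real vec \<Rightarrow> bool" where
  "has_hessian f H u \<longleftrightarrow>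
     H \<in> carrier_mat (dim_vec u) (dim_vec u) \<and>
     (\<forall>k < dim_vec u. \<forall>l < dim_vec u. \<exists>G.
        (\<forall>\<^sub>F t in nhds (u $ k). has_partial_derivative f (G t) l (u |\<^sub>v k \<mapsto> t)) \<and>
        (G has_real_derivative H $$ (k, l)) (at (u $ k)))"

text \<open>Primitive quantities in terms of the conservative variables
  \<open>u = (h, h u_m, h \<alpha>_1, ..., h \<alpha>_N)\<close>; \<open>moment i\<close> is meant for \<open>1 \<le> i \<le> N\<close>.\<close>

definition height :: "real vec \<Rightarrow> real" where
  "height u = u $ 0"

definition mean_velocity :: "real vec \<Rightarrow> real" where
  "mean_velocity u = u $ 1 / height u"

definition moment :: "nat \<Rightarrow> real vec \<Rightarrow> real" where
  "moment i u = u $ (i + 1) / height u"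

definition swme_energy :: "nat \<Rightarrow> real \<Rightarrow> real \<Rightarrow> real vec \<Rightarrow> real" where
  "swme_energy N g b u =
     height u * (mean_velocity u)\<^sup>2 / 2
     + height u / 2 * (\<Sum>i = 1..N. (moment i u)\<^sup>2 / real (2 * i + 1))
     + g * (height u)\<^sup>2 / 2 + g * height u * b"

text \<open>First row, and also first column, of the matrix below, without the corner entry.\<close>

definition swme_hessian_border :: "real vec \<Rightarrow> nat \<Rightarrow> real" where
  "swme_hessian_border u j =
     (if j = 0 then - mean_velocity u else - (moment j u / real (2 * j + 1)))"

definition swme_hessian :: "nat \<Rightarrow> real \<Rightarrow> real vec \<Rightarrow> real mat" where
  "swme_hessian N g u =
     (1 / height u) \<cdot>\<^sub>m four_block_mat
       (mat 1 1 (\<lambda>_. g * height u + (mean_velocity u)\<^sup>2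
                      + (\<Sum>i = 1..N. (moment i u)\<^sup>2 / real (2 * i + 1))))
       (mat 1 (N + 1) (\<lambda>(_, j). swme_hessian_border u j))
       (mat (N + 1) 1 (\<lambda>(i, _). swme_hessian_border u i))
       (mat_diag (N + 1) (\<lambda>i. 1 / real (2 * i + 1)))"

end

theory Submission
  imports Defs
begin

text \<open>
  The mean velocity is the moment of index \<open>0\<close>: it is \<open>u $ 1 / height u\<close>, and its weight
  \<open>1 / (2 * 0 + 1)\<close> is \<open>1\<close>. In the conservative variables the energy is therefore
  \<open>E u = Q u / (2 * u $ 0) + g * (u $ 0)\<^sup>2 / 2 + g * b * u $ 0\<close>, where \<open>Q\<close> is a diagonal
  quadratic form in the components \<open>u $ 1, ..., u $ (N + 1)\<close>. It splits into the potential energy of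
  \<open>u $ 0\<close> alone and a quotient that the quotient rule differentiates; this gives the entropy variables
  (lemma \<open>swme_energy_partial_derivative\<close>).

  These formulas hold wherever \<open>u $ 0 \<noteq> 0\<close>. This condition is stable under small changes of one
  component, so the second derivatives are the partial derivatives of the entropy variables, which
  are again rational functions of the same kind (lemma \<open>swme_entropy_variable_partial_derivative\<close>).
\<close>

lemma update_vec_same: "u |\<^sub>v k \<mapsto> (u $ k) = u"
  by (intro eq_vecI) (auto simp: update_vec_def)

text \<open>Moving the component \<open>k\<close> changes only that component; the derivative of every function below
  comes from this rule and the differentiation rules for real functions.\<close>

lemma component_has_derivative:
  assumes "i < dim_vec u"
  shows "((\<lambda>t. (u |\<^sub>v k \<mapsto> t) $ i) has_real_derivative of_bool (i = k)) (at s)"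
  using assms by (cases "i = k") auto

text \<open>The inner derivative in the definition of the Hessian is needed on a whole neighbourhood. For a
  function that is differentiated by one formula wherever component \<open>0\<close> is nonzero, the values of that
  formula serve as inner derivatives.\<close>

lemma has_hessian_if_partial_derivatives:
  assumes H: "H \<in> carrier_mat (dim_vec u) (dim_vec u)"
    and nz: "u $ 0 \<noteq> 0" and dim: "0 < dim_vec u"
    and first: "\<And>v l. \<lbrakk>dim_vec v = dim_vec u; v $ 0 \<noteq> 0; l < dim_vec u\<rbrakk>
                  \<Longrightarrow> has_partial_derivative f (w l v) l v"
    and second: "\<And>k l. \<lbrakk>k < dim_vec u; l < dim_vec u\<rbrakk>
                  \<Longrightarrow> has_partial_derivative (w l) (H $$ (k, l)) k u"
  shows "has_hessian f H u"
  unfolding has_hessian_def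
proof (intro conjI allI impI exI)
  fix k l assume k: "k < dim_vec u" and l: "l < dim_vec u"
  have "isCont (\<lambda>t. (u |\<^sub>v k \<mapsto> t) $ 0) (u $ k)"
    using component_has_derivative[OF dim] by (rule DERIV_isCont)
  then have "((\<lambda>t. (u |\<^sub>v k \<mapsto> t) $ 0) \<longlongrightarrow> u $ 0) (nhds (u $ k))"
    using tendsto_at_iff_tendsto_nhds[of "\<lambda>t. (u |\<^sub>v k \<mapsto> t) $ 0" "u $ k"]
    by (simp add: isCont_def update_vec_same)
  then have "\<forall>\<^sub>F t in nhds (u $ k). (u |\<^sub>v k \<mapsto> t) $ 0 \<noteq> 0"
    using nz by (rule tendsto_imp_eventually_ne)
  then show "\<forall>\<^sub>F t in nhds (u $ k).
      has_partial_derivative f (w l (u |\<^sub>v k \<mapsto> t)) l (u |\<^sub>v k \<mapsto> t)"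
    by (rule eventually_mono) (use l in \<open>auto intro: first\<close>)
  show "((\<lambda>t. w l (u |\<^sub>v k \<mapsto> t)) has_real_derivative H $$ (k, l)) (at (u $ k))"
    using second[OF k l] by (simp add: has_partial_derivative_def)
qed (rule H)

text \<open>For \<open>u $ 0 \<noteq> 0\<close> this is \<open>(u $ 0)\<^sup>2\<close> times the weighted sum of the squared moments; the summand
  \<open>i = 0\<close> is the contribution of the mean velocity.\<close>

definition moment_form :: "nat \<Rightarrow> real vec \<Rightarrow> real" where
  "moment_form N u = (\<Sum>i\<le>N. (u $ (i + 1))\<^sup>2 / real (2 * i + 1))"

lemma sum_moments_eq_moment_form:
  "(mean_velocity u)\<^sup>2 + (\<Sum>i = 1..N. (moment i u)\<^sup>2 / real (2 * i + 1))
     = moment_form N u / (u $ 0)\<^sup>2"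
proof -
  have "moment_form N u / (u $ 0)\<^sup>2 = (\<Sum>i\<le>N. (moment i u)\<^sup>2 / real (2 * i + 1))"
    by (simp add: moment_form_def moment_def height_def sum_divide_distrib power_divide mult.commute)
  then show ?thesis
    by (simp add: sum.atMost_shift sum.atLeast1_atMost_eq lessThan_Suc_atMost
        moment_def mean_velocity_def)
qed

text \<open>Only one factor \<open>u $ 0\<close> stays in the denominator, because the kinetic energy is the height
  times a form that is quadratic in the quotients \<open>u $ (i + 1) / u $ 0\<close>.\<close>

lemma swme_energy_conservative:
  "swme_energy N g b u = moment_form N u / (2 * u $ 0) + g * (u $ 0)\<^sup>2 / 2 + g * u $ 0 * b"
proof -
  have "swme_energy N g b u = u $ 0 / 2 * (moment_form N u / (u $ 0)\<^sup>2)
          + g * (u $ 0)\<^sup>2 / 2 + g * u $ 0 * b"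
    by (simp add: swme_energy_def height_def algebra_simps flip: sum_moments_eq_moment_form)
  then show ?thesis
    by (simp add: power2_eq_square)
qed

text \<open>Component \<open>l > 0\<close> carries the moment of index \<open>l - 1\<close>, whose weight has the denominator
  \<open>2 * (l - 1) + 1 = 2 * l - 1\<close>.\<close>

definition swme_entropy_variable :: "nat \<Rightarrow> real \<Rightarrow> real \<Rightarrow> nat \<Rightarrow> real vec \<Rightarrow> real" where
  "swme_entropy_variable N g b l u =
     (if l = 0 then - (moment_form N u / (2 * (u $ 0)\<^sup>2)) + g * (u $ 0 + b)
      else u $ l / (real (2 * l - 1) * u $ 0))"

text \<open>Component \<open>0\<close> does not occur in the form, and any other component occurs in exactly one
  summand.\<close>

lemma moment_form_has_derivative:
  assumes "dim_vec u = N + 2" and "k < N + 2"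
  shows "((\<lambda>t. moment_form N (u |\<^sub>v k \<mapsto> t)) has_real_derivative
           (if k = 0 then 0 else 2 * u $ k / real (2 * k - 1))) (at (u $ k))"
proof -
  have "((\<lambda>t. moment_form N (u |\<^sub>v k \<mapsto> t)) has_real_derivative
          (\<Sum>i\<le>N. 2 * u $ (i + 1) * of_bool (i + 1 = k) / real (2 * i + 1))) (at (u $ k))"
    unfolding moment_form_def using assms
    by (intro DERIV_sum) (auto intro!: derivative_eq_intros component_has_derivative
        simp: update_vec_same)
  also have "(\<Sum>i\<le>N. 2 * u $ (i + 1) * of_bool (i + 1 = k) / real (2 * i + 1))
               = (if k = 0 then 0 else 2 * u $ k / real (2 * k - 1))"
  proof (cases k)
    case (Suc j)
    then have "(\<Sum>i\<le>N. 2 * u $ (i + 1) * of_bool (i + 1 = k) / real (2 * i + 1))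
                 = (\<Sum>i\<le>N. if i = j then 2 * u $ (i + 1) / real (2 * i + 1) else 0)"
      by (intro sum.cong) auto
    then show ?thesis
      using Suc assms by simp
  qed simp
  finally show ?thesis .
qed

lemma swme_energy_partial_derivative:
  assumes "dim_vec u = N + 2" and "u $ 0 \<noteq> 0" and "l < N + 2"
  shows "has_partial_derivative (swme_energy N g b) (swme_entropy_variable N g b l u) l u"
  unfolding has_partial_derivative_def swme_energy_conservative swme_entropy_variable_def
  using assms
  by (auto intro!: derivative_eq_intros component_has_derivative[THEN DERIV_cong]
      moment_form_has_derivative[THEN DERIV_cong] simp: update_vec_same)
    (simp_all add: field_simps power2_eq_square)

text \<open>The block matrix is written in primitive quantities, each of which hides a division by the
  height. Clearing them brings the entries into the form that differentiating
  \<open>swme_entropy_variable\<close> produces: for instance, the corner entry is the derivative of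
  \<open>- moment_form N u / (2 * (u $ 0)\<^sup>2) + g * (u $ 0 + b)\<close> with respect to \<open>u $ 0\<close>.\<close>

lemma swme_hessian_index:
  assumes "k < N + 2" and "l < N + 2" and "u $ 0 \<noteq> 0"
  shows "swme_hessian N g u $$ (k, l) =
    (if k = 0 \<and> l = 0 then g + moment_form N u / (u $ 0) ^ 3
     else if k = 0 then - u $ l / (real (2 * l - 1) * (u $ 0)\<^sup>2)
     else if l = 0 then - u $ k / (real (2 * k - 1) * (u $ 0)\<^sup>2)
     else if k = l then 1 / (real (2 * k - 1) * u $ 0) else 0)"
proof -
  have "swme_hessian N g u $$ (0, 0) = (g * u $ 0 + moment_form N u / (u $ 0)\<^sup>2) / u $ 0"
    by (simp add: swme_hessian_def height_def mat_diag_def flip: sum_moments_eq_moment_form)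
  then show ?thesis
    using assms
    by (cases k; cases l)
      (simp_all add: swme_hessian_def mat_diag_def swme_hessian_border_def height_def
        mean_velocity_def moment_def power2_eq_square power3_eq_cube add_divide_distrib)
qed

lemma swme_entropy_variable_partial_derivative:
  assumes "dim_vec u = N + 2" and "u $ 0 \<noteq> 0" and "k < N + 2" and "l < N + 2"
  shows "has_partial_derivative (swme_entropy_variable N g b l) (swme_hessian N g u $$ (k, l)) k u"
  unfolding has_partial_derivative_def swme_entropy_variable_def swme_hessian_index[OF assms(3,4,2)]
  using assms
  by (auto intro!: derivative_eq_intros component_has_derivative[THEN DERIV_cong]
      moment_form_has_derivative[THEN DERIV_cong] simp: update_vec_same)
    (simp_all add: field_simps power2_eq_square power3_eq_cube power4_eq_xxxx)

theorem corollary1: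
  fixes N :: nat and g b :: real and u :: "real vec"
  assumes "N \<ge> 1" and "g > 0" and "u \<in> carrier_vec (N + 2)" and "height u > 0"
  shows "has_partial_derivative (swme_energy N g b)
           (- ((mean_velocity u)\<^sup>2 / 2)
            - 1 / 2 * (\<Sum>i = 1..N. (moment i u)\<^sup>2 / real (2 * i + 1))
            + g * (height u + b)) 0 u \<and>
         has_partial_derivative (swme_energy N g b) (mean_velocity u) 1 u \<and>
         (\<forall>i \<in> {1..N}.
           has_partial_derivative (swme_energy N g b) (moment i u / real (2 * i + 1)) (i + 1) u) \<and>
         has_hessian (swme_energy N g b) (swme_hessian N g u) u"
proof -
  have dim: "dim_vec u = N + 2" and nz: "u $ 0 \<noteq> 0"
    using assms by (auto simp: height_def)
  note first = swme_energy_partial_derivative[OF dim nz, of _ g b]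
  have "swme_entropy_variable N g b 0 u = - ((mean_velocity u)\<^sup>2 / 2)
          - 1 / 2 * (\<Sum>i = 1..N. (moment i u)\<^sup>2 / real (2 * i + 1)) + g * (height u + b)"
    using sum_moments_eq_moment_form[of u N]
    by (simp add: swme_entropy_variable_def height_def)
  moreover have "swme_entropy_variable N g b 1 u = mean_velocity u"
    by (simp add: swme_entropy_variable_def mean_velocity_def height_def)
  moreover have "swme_entropy_variable N g b (i + 1) u = moment i u / real (2 * i + 1)" for i
    by (simp add: swme_entropy_variable_def moment_def height_def)
  moreover have "has_hessian (swme_energy N g b) (swme_hessian N g u) u"
  proof (rule has_hessian_if_partial_derivatives[where w = "swme_entropy_variable N g b"])
    show "swme_hessian N g u \<in> carrier_mat (dim_vec u) (dim_vec u)"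
      by (rule carrier_matI) (simp_all add: swme_hessian_def mat_diag_def dim)
  qed (use dim nz in \<open>auto intro: swme_energy_partial_derivative
      swme_entropy_variable_partial_derivative\<close>)
  ultimately show ?thesis
    using first[of 0] first[of 1] first[of "i + 1" for i] by simp
qed

end
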